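(* Let $(H;\langle\cdot,\cdot\rangle)$ be an inner product space over $\mathbb{K}$ ($\mathbb{K}=\mathbb{C}$ or $\mathbb{R}$). Let $x,y,e\in H$ with $\|e\|=1$, and let $a,A,b,B\in\mathbb{K}$ be scalars such that $\operatorname{Re}(\bar a A)>0$ and $\operatorname{Re}(\bar b B)>0$. If $$\operatorname{Re}\langle Ae-x,\,x-ae\rangle\ge 0\quad\text{and}\quad \operatorname{Re}\langle Be-y,\,y-be\rangle\ge 0,$$ or, equivalently, $$\left\|x-\frac{a+A}{2}e\right\|\le\frac12|A-a|\quad\text{and}\quad\left\|y-\frac{b+B}{2}e\right\|\le\frac12|B-b|,$$ then $$|\langle x,y\rangle-\langle x,e\rangle\langle e,y\rangle|\le\frac14 M(a,A)\,M(b,B)\,|\langle x,e\rangle\langle e,y\rangle|,$$ where $$M(a,A):=\left[\frac{(|A|-|a|)^2+4\left[|A\bar a|-\operatorname{Re}(A\bar a)\right]}{\operatorname{Re}(\bar a A)}\right]^{1/2}$$ and $M(b,B)$ is defined by the same formula with $(b,B)$ in place of $(a,A)$. The constant $\frac14$ is best possible in the sense that it cannot be replaced by a smaller constant (i.e. no constant smaller than $\frac14$ makes the inequality valid for all such inner product spaces, vectors and scalars).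
   Context: The inner product is linear in the first argument and conjugate-linear in the second; $\|\cdot\|$ is the norm induced by the inner product. *)

theory Defs
  imports "HOL-Analysis.Analysis"
begin

text \<open>
  The scalar field \<open>\<K>\<close>, where \<open>\<K>\<close> is \<open>\<real>\<close> or \<open>\<complex>\<close>: \<open>scnj\<close> is conjugation, \<open>sre\<close> is the real part and
  \<open>norm\<close> is the absolute value.  Both fields are instances below, and
  \<open>rc_scalar_real_or_complex\<close> shows that there are no others up to isomorphism.
\<close>

class rc_scalar = real_normed_field +
  fixes scnj :: "'a \<Rightarrow> 'a"
    and sre :: "'a \<Rightarrow> real"
  assumes scnj_add: "scnj (z + w) = scnj z + scnj w"
    and mult_scnj_scaleR: "z * scnj z = (norm z)\<^sup>2 *\<^sub>R 1"
    and scaleR_sre: "sre z *\<^sub>R 1 = (z + scnj z) / 2"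

lemma mult_scnj: "z * scnj z = of_real ((norm (z :: 'a :: rc_scalar))\<^sup>2)"
  by (simp only: mult_scnj_scaleR of_real_def)

lemma of_real_sre: "of_real (sre z) = (z + scnj (z :: 'a :: rc_scalar)) / 2"
  by (simp only: scaleR_sre of_real_def)

instantiation real :: rc_scalar
begin
definition scnj_real :: "real \<Rightarrow> real" where [simp]: "scnj_real z = z"
definition sre_real :: "real \<Rightarrow> real" where [simp]: "sre_real z = z"
instance by standard (auto simp: power2_eq_square)
end

instantiation complex :: rc_scalar
begin
definition scnj_complex :: "complex \<Rightarrow> complex" where [simp]: "scnj_complex = cnj"
definition sre_complex :: "complex \<Rightarrow> real" where [simp]: "sre_complex = Re"
instance
proof
  fix z w :: complex
  show "scnj (z + w) = scnj z + scnj w" by simp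
  show "z * scnj z = (norm z)\<^sup>2 *\<^sub>R 1"
    by (simp add: complex_norm_square [symmetric] scaleR_conv_of_real del: of_real_power)
  show "sre z *\<^sub>R 1 = (z + scnj z) / 2"
    by (simp add: complex_add_cnj scaleR_conv_of_real)
qed
end

lemma scnj_zero [simp]: "scnj (0 :: 'a :: rc_scalar) = 0"
  using scnj_add[of "0 :: 'a" 0] by simp

lemma scnj_minus: "scnj (- z) = - scnj (z :: 'a :: rc_scalar)"
  using scnj_add[of z "- z"] by (simp add: add_eq_0_iff)

lemma scnj_mult: "scnj (z * w) = scnj z * scnj (w :: 'a :: rc_scalar)"
proof (cases "z = 0 \<or> w = 0")
  case False
  have "z * w * scnj (z * w) = (z * scnj z) * (w * scnj w)"
    by (simp only: mult_scnj norm_mult power_mult_distrib of_real_mult)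
  also have "\<dots> = z * w * (scnj z * scnj w)" by (simp add: mult_ac)
  finally show ?thesis using False by simp
qed auto

lemma norm_scnj [simp]: "norm (scnj z) = norm (z :: 'a :: rc_scalar)"
proof (cases "z = 0")
  case False
  have "norm (z * scnj z) = norm z * norm z"
    unfolding mult_scnj norm_of_real by (simp add: power2_eq_square)
  thus ?thesis using False by (simp add: norm_mult)
qed auto

lemma scnj_scnj [simp]: "scnj (scnj z) = (z :: 'a :: rc_scalar)"
proof (cases "z = 0")
  case False
  hence "scnj z \<noteq> 0" by (metis norm_scnj norm_eq_zero)
  moreover have "scnj z * scnj (scnj z) = scnj z * z"
    using mult_scnj[of z] mult_scnj[of "scnj z"] by (simp add: mult.commute)
  ultimately show ?thesis by simp
qed auto

lemma scnj_of_real [simp]: "scnj (of_real r) = (of_real r :: 'a :: rc_scalar)"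
proof (cases "r = 0")
  case False
  have "of_real r * scnj (of_real r) = of_real r * (of_real r :: 'a)"
    by (simp only: mult_scnj norm_of_real power2_abs) (simp add: power2_eq_square)
  thus ?thesis using False by simp
qed auto

lemma scnj_fixed_imp_real: "scnj z = z \<Longrightarrow> z = of_real (sre (z :: 'a :: rc_scalar))"
  by (simp add: of_real_sre)

lemma rc_scalar_real_or_complex:
  "(\<forall>z :: 'a :: rc_scalar. \<exists>r. z = of_real r) \<or>
   (\<exists>i :: 'a. i * i = - 1 \<and> (\<forall>z. \<exists>r s. z = of_real r + of_real s * i))"
proof (cases "\<forall>z :: 'a. scnj z = z")
  case True
  thus ?thesis using scnj_fixed_imp_real by blast
next
  case False
  then obtain z :: 'a where z: "scnj z \<noteq> z" by blast
  define w where "w = z - scnj z"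
  define i where "i = w * of_real (1 / norm w)"
  have w0: "w \<noteq> 0" using z by (simp add: w_def)
  have cw: "scnj w = - w"
    using scnj_add[of z "- scnj z"] by (simp add: w_def scnj_minus)
  have ci: "scnj i = - i" by (simp add: i_def scnj_mult cw del: of_real_divide)
  have ni: "norm i = 1" using w0 by (simp add: i_def norm_mult norm_divide)
  have ii: "i * i = - 1"
    using mult_scnj[of i] by (simp add: ci ni minus_equation_iff)
  have "\<exists>r s. u = of_real r + of_real s * i" for u :: 'a
  proof -
    define v where "v = u - of_real (sre u)"
    have v: "v = (u - scnj u) / 2"
      by (simp add: v_def of_real_sre field_simps)
    have v2: "2 * v = u - scnj u" by (simp add: v)
    have "2 * scnj v = scnj (2 * v)"
      using scnj_mult[of 2 v] scnj_of_real[of 2, where 'a = 'a] by simp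
    also have "\<dots> = - (2 * v)"
      using scnj_add[of u "- scnj u"] by (simp add: v2 scnj_minus)
    finally have cv: "scnj v = - v" by (metis mult_cancel_left mult_minus_right zero_neq_numeral)
    have "v * i = of_real (sre (v * i))"
      by (rule scnj_fixed_imp_real) (simp add: scnj_mult cv ci)
    moreover have "v = - (v * i) * i" by (simp add: mult.assoc ii)
    ultimately have "v = of_real (- sre (v * i)) * i" by (metis of_real_minus)
    hence "u = of_real (sre u) + of_real (- sre (v * i)) * i"
      unfolding v_def by (metis add.commute diff_add_cancel)
    thus ?thesis by blast
  qed
  thus ?thesis using ii by blast
qed

locale inner_product_space = vector_space scale
  for scale :: "'k :: rc_scalar \<Rightarrow> 'v :: ab_group_add \<Rightarrow> 'v" +
  fixes ip :: "'v \<Rightarrow> 'v \<Rightarrow> 'k"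
  assumes ip_add_left: "ip (u + v) w = ip u w + ip v w"
    and ip_scale_left: "ip (scale k u) w = k * ip u w"
    and ip_commute: "ip u v = scnj (ip v u)"
    and ip_nonneg: "0 \<le> sre (ip u u)"
    and ip_definite: "ip u u = 0 \<Longrightarrow> u = 0"

text \<open>Since \<open>ip u u\<close> is fixed by conjugation, it equals its real part.\<close>

definition ip_norm :: "('v \<Rightarrow> 'v \<Rightarrow> 'k :: rc_scalar) \<Rightarrow> 'v \<Rightarrow> real" where
  "ip_norm ip u = sqrt (sre (ip u u))"

lemma inner_product_space_real_inner:
  "inner_product_space (scaleR :: real \<Rightarrow> 'v :: real_inner \<Rightarrow> 'v) inner"
  by unfold_locales (auto simp: algebra_simps inner_commute)

lemma ip_norm_real_inner: "ip_norm inner = (norm :: 'v :: real_inner \<Rightarrow> real)"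
  by (simp add: ip_norm_def norm_eq_sqrt_inner fun_eq_iff)

definition M :: "'k :: rc_scalar \<Rightarrow> 'k \<Rightarrow> real" where
  "M a A = sqrt (((norm A - norm a)\<^sup>2 + 4 * (norm (A * scnj a) - sre (A * scnj a)))
                   / sre (scnj a * A))"

end

theory Submission
  imports Defs
begin

text \<open>
  Put \<open>p = \<langle>x, e\<rangle>\<close> and \<open>R = Re (cnj a A)\<close>.  The hypothesis on \<open>x\<close> expands to
  \<open>\<parallel>x\<parallel>\<^sup>2 + R \<le> Re (cnj p (a + A)) \<le> \<bar>p\<bar> (\<bar>a\<bar> + \<bar>A\<bar>)\<close>, and AM-GM bounds the right-hand side by
  \<open>R + \<bar>p\<bar>\<^sup>2 (\<bar>a\<bar> + \<bar>A\<bar>)\<^sup>2 / (4 R)\<close>.  As \<open>M(a, A)\<^sup>2 = (\<bar>a\<bar> + \<bar>A\<bar>)\<^sup>2 / R - 4\<close>, this says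
  \<open>\<parallel>x - p e\<parallel>\<^sup>2 \<le> M(a, A)\<^sup>2 \<bar>p\<bar>\<^sup>2 / 4\<close>.  Cauchy-Schwarz for the components of \<open>x\<close> and \<open>y\<close>
  orthogonal to \<open>e\<close> gives the inequality.  All these estimates are equalities for
  \<open>x = y = (8/5, 6/5)\<close>, \<open>e = (1, 0)\<close>, \<open>a = b = 1\<close>, \<open>A = B = 4\<close>.
\<close>

section \<open>Real parts and norms of scalars\<close>

lemma sre_of_real [simp]: "sre (of_real r :: 'a :: rc_scalar) = r"
proof -
  have "(of_real (sre (of_real r :: 'a)) :: 'a) = of_real r"
    by (simp add: of_real_sre)
  thus ?thesis by (simp only: of_real_eq_iff)
qed

lemma sre_zero [simp]: "sre (0 :: 'a :: rc_scalar) = 0"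
  using sre_of_real[of 0, where 'a = 'a] by simp

text \<open>After embedding by \<open>of_real\<close>, real parts have the explicit form
  \<open>(z + scnj z) / 2\<close>; injectivity of \<open>of_real\<close> carries the identity
  back.\<close>

lemma sre_add: "sre (z + w) = sre z + sre (w :: 'a :: rc_scalar)"
proof -
  have "(of_real (sre (z + w)) :: 'a) = of_real (sre z + sre w)"
    by (simp add: of_real_sre scnj_add field_simps)
  thus ?thesis by (simp only: of_real_eq_iff)
qed

lemma sre_minus: "sre (- z) = - sre (z :: 'a :: rc_scalar)"
  using sre_add[of z "- z"] by simp

lemma sre_diff: "sre (z - w) = sre z - sre (w :: 'a :: rc_scalar)"
  using sre_add[of z "- w"] by (simp add: sre_minus)

lemma scnj_diff: "scnj (z - w) = scnj z - scnj (w :: 'a :: rc_scalar)"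
  using scnj_add[of z "- w"] by (simp add: scnj_minus)

lemma sre_scnj [simp]: "sre (scnj z) = sre (z :: 'a :: rc_scalar)"
proof -
  have "(of_real (sre (scnj z)) :: 'a) = of_real (sre z)"
    by (simp add: of_real_sre add.commute)
  thus ?thesis by (simp only: of_real_eq_iff)
qed

lemma sre_scnj_mult: "sre (scnj z * w) = sre (scnj w * (z :: 'a :: rc_scalar))"
  using sre_scnj[of "scnj z * w"] by (simp add: scnj_mult mult.commute)

lemma sre_of_real_mult: "sre (of_real r * z) = r * sre (z :: 'a :: rc_scalar)"
proof -
  have "(of_real (sre (of_real r * z)) :: 'a) = of_real (r * sre z)"
    by (simp add: of_real_sre scnj_mult field_simps)
  thus ?thesis by (simp only: of_real_eq_iff)
qed

lemma abs_sre_le_norm: "\<bar>sre z\<bar> \<le> norm (z :: 'a :: rc_scalar)"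
proof -
  have "\<bar>sre z\<bar> = norm ((z + scnj z) / 2)"
    by (metis norm_of_real of_real_sre)
  also have "\<dots> \<le> (norm z + norm (scnj z)) / 2"
    \<comment> \<open>\<open>norm_scnj\<close> is withheld so that the bound keeps the shape of the
      triangle inequality.\<close>
    by (simp add: norm_divide norm_triangle_ineq divide_right_mono del: norm_scnj)
  finally show ?thesis by simp
qed

lemma sre_scnj_mult_self: "sre (scnj z * z) = (norm (z :: 'a :: rc_scalar))\<^sup>2"
  by (simp only: mult.commute[of _ z] mult_scnj sre_of_real)

lemma scnj_numeral [simp]: "scnj (numeral n :: 'a :: rc_scalar) = numeral n"
  using scnj_of_real[of "numeral n", where 'a = 'a] by simp

lemma scnj_one [simp]: "scnj (1 :: 'a :: rc_scalar) = 1"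
  using scnj_of_real[of 1, where 'a = 'a] by simp

lemma sre_numeral [simp]: "sre (numeral n :: 'a :: rc_scalar) = numeral n"
  using sre_of_real[of "numeral n", where 'a = 'a] by simp

lemma sre_one [simp]: "sre (1 :: 'a :: rc_scalar) = 1"
  using sre_of_real[of 1, where 'a = 'a] by simp

lemma scnj_divide: "scnj (z / w) = scnj z / scnj (w :: 'a :: rc_scalar)"
proof (cases "w = 0")
  case False
  hence "scnj w \<noteq> 0" by (metis norm_scnj norm_eq_zero)
  thus ?thesis using False scnj_mult[of "z / w" w] by (simp add: field_simps)
qed simp

lemma norm_add_square:
  "(norm (z + w))\<^sup>2 = (norm z)\<^sup>2 + 2 * sre (scnj z * w) + (norm (w :: 'a :: rc_scalar))\<^sup>2"
proof -
  have "(norm (z + w))\<^sup>2 = sre (scnj z * z) + sre (scnj z * w) + sre (scnj w * z) + sre (scnj w * w)"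
    by (simp add: sre_scnj_mult_self[symmetric] scnj_add algebra_simps sre_add)
  thus ?thesis by (simp add: sre_scnj_mult_self sre_scnj_mult[of w z])
qed

lemma norm_diff_square:
  "(norm (z - w))\<^sup>2 = (norm z)\<^sup>2 - 2 * sre (scnj z * w) + (norm (w :: 'a :: rc_scalar))\<^sup>2"
  using norm_add_square[of z "- w"] by (simp add: sre_minus)

text \<open>Since \<open>norm (A * scnj a) = norm A * norm a\<close>, the numerator under the root
  is \<open>(norm a + norm A)^2 - 4 * sre (scnj a * A)\<close>. It is nonnegative because a real
  part never exceeds the modulus, so squaring removes the root.\<close>

lemma M_nonneg: "0 < sre (scnj a * A) \<Longrightarrow> 0 \<le> M a A"
  and M_square: "0 < sre (scnj a * A) \<Longrightarrow>
    (M a A)\<^sup>2 = (norm a + norm A)\<^sup>2 / sre (scnj a * A) - 4"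
proof -
  assume R: "0 < sre (scnj a * A)"
  have "sre (A * scnj a) \<le> norm (A * scnj a)"
    using abs_sre_le_norm[of "A * scnj a"] by linarith
  hence *: "0 \<le> ((norm A - norm a)\<^sup>2 + 4 * (norm (A * scnj a) - sre (A * scnj a)))
                   / sre (scnj a * A)"
    using R by (intro divide_nonneg_pos add_nonneg_nonneg) auto
  thus "0 \<le> M a A" by (simp add: M_def)
  have "(M a A)\<^sup>2 = ((norm A - norm a)\<^sup>2 + 4 * (norm (A * scnj a) - sre (A * scnj a)))
                   / sre (scnj a * A)"
    using * by (simp add: M_def)
  also have "\<dots> = (norm a + norm A)\<^sup>2 / sre (scnj a * A) - 4"
    using R unfolding mult.commute[of A] by (simp add: norm_mult field_simps power2_eq_square)
  finally show "(M a A)\<^sup>2 = (norm a + norm A)\<^sup>2 / sre (scnj a * A) - 4" .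
qed

section \<open>Cauchy-Schwarz and the Gruess estimate\<close>

context inner_product_space
begin

lemma ip_add_right: "ip u (v + w) = ip u v + ip u w"
  by (metis ip_add_left ip_commute scnj_add)

lemma ip_scale_right: "ip u (scale k v) = scnj k * ip u v"
  by (metis ip_commute ip_scale_left scnj_mult)

lemma ip_diff_left: "ip (u - v) w = ip u w - ip v w"
  using ip_add_left[of "u - v" v w] by simp

lemma ip_diff_right: "ip u (v - w) = ip u v - ip u w"
  using ip_add_right[of u "v - w" w] by simp

lemma ip_zero_right [simp]: "ip u 0 = 0"
  using ip_diff_right[of u 0 0] by simp

lemma ip_self: "ip u u = of_real (sre (ip u u))"
  by (rule scnj_fixed_imp_real[OF ip_commute[symmetric]])

lemma ip_self_pos: "u \<noteq> 0 \<Longrightarrow> 0 < sre (ip u u)"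
  using ip_nonneg[of u] ip_definite[of u] ip_self[of u] by (metis of_real_0 order_less_le)

lemma sre_ip_diff_scale:
  "sre (ip (u - scale l v) (u - scale l v)) =
    sre (ip u u) - 2 * sre (scnj l * ip u v) + (norm l)\<^sup>2 * sre (ip v v)"
proof -
  have "ip (u - scale l v) (u - scale l v) =
      ip u u - scnj l * ip u v - scnj (scnj l * ip u v) + (l * scnj l) * ip v v"
    by (simp add: ip_diff_left ip_diff_right ip_scale_left ip_scale_right scnj_mult
        ip_commute[of v u] algebra_simps)
  thus ?thesis
    by (simp only: mult_scnj sre_add sre_diff sre_scnj sre_of_real_mult)
qed

lemma Cauchy_Schwarz: "(norm (ip u v))\<^sup>2 \<le> sre (ip u u) * sre (ip v v)"
proof (cases "v = 0")
  case False
  define V where "V = sre (ip v v)"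
  have V: "0 < V" using ip_self_pos[OF False] by (simp add: V_def)
  \<comment> \<open>\<open>l\<close> is the coefficient of the orthogonal projection of
    \<open>u\<close> on \<open>v\<close>; the squared norm of the residual is nonnegative.\<close>
  define l where "l = of_real (1 / V) * ip u v"
  have "scnj l * ip u v = of_real (1 / V) * (scnj (ip u v) * ip u v)"
    by (simp add: l_def scnj_mult del: of_real_divide)
  hence *: "sre (scnj l * ip u v) = (norm (ip u v))\<^sup>2 / V"
    by (simp only: sre_of_real_mult sre_scnj_mult_self) simp
  have "norm l = norm (ip u v) / V"
    using V by (simp add: l_def norm_mult norm_divide)
  hence "0 \<le> sre (ip u u) - (norm (ip u v))\<^sup>2 / V"
    using ip_nonneg[of "u - scale l v"] V
    by (simp add: sre_ip_diff_scale * V_def[symmetric] power2_eq_square)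
  thus ?thesis using V by (simp add: field_simps V_def)
qed simp

text \<open>Thales: \<open>scale a e\<close> and \<open>scale A e\<close> end a diameter, so the
  product is the squared radius minus the squared distance of \<open>x\<close> from the midpoint.
  The second form isolates the squared norm of \<open>x\<close> for the residual estimate.\<close>

lemma sre_ip_eq_ball:
  assumes "sre (ip e e) = 1"
  shows "sre (ip (scale A e - x) (x - scale a e)) =
    (norm (A - a) / 2)\<^sup>2 - sre (ip (x - scale ((a + A) / 2) e) (x - scale ((a + A) / 2) e))"
    and "sre (ip (scale A e - x) (x - scale a e)) =
    sre (scnj (a + A) * ip x e) - sre (ip x x) - sre (scnj a * A)"
proof -
  have e: "ip e e = 1" using ip_self[of e] assms by simp
  have "ip (scale A e - x) (x - scale a e) =
      scnj (scnj A * ip x e) - scnj a * A - ip x x + scnj a * ip x e"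
    by (simp add: ip_diff_left ip_diff_right ip_scale_left ip_scale_right scnj_mult e
        ip_commute[of e x] algebra_simps)
  thus 1: "sre (ip (scale A e - x) (x - scale a e)) =
      sre (scnj (a + A) * ip x e) - sre (ip x x) - sre (scnj a * A)"
    by (simp add: sre_add sre_diff scnj_add distrib_right)
  have "scnj ((a + A) / 2) * ip x e = of_real (1 / 2) * (scnj (a + A) * ip x e)"
    by (simp add: scnj_divide)
  hence 2: "2 * sre (scnj ((a + A) / 2) * ip x e) = sre (scnj (a + A) * ip x e)"
    by (simp only: sre_of_real_mult)
  have 3: "(norm ((a + A) / 2))\<^sup>2 = ((norm a)\<^sup>2 + 2 * sre (scnj a * A) + (norm A)\<^sup>2) / 4"
    by (simp add: norm_divide power_divide norm_add_square)
  have 4: "(norm (A - a) / 2)\<^sup>2 = ((norm a)\<^sup>2 - 2 * sre (scnj a * A) + (norm A)\<^sup>2) / 4"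
    by (simp add: power_divide norm_diff_square sre_scnj_mult[of A a])
  show "sre (ip (scale A e - x) (x - scale a e)) =
    (norm (A - a) / 2)\<^sup>2 - sre (ip (x - scale ((a + A) / 2) e) (x - scale ((a + A) / 2) e))"
    unfolding sre_ip_diff_scale 1 2 3 4 assms by (simp add: field_simps)
qed

lemma sre_ip_nonneg_iff_ball:
  assumes "ip_norm ip e = 1"
  shows "0 \<le> sre (ip (scale A e - x) (x - scale a e)) \<longleftrightarrow>
    ip_norm ip (x - scale ((a + A) / 2) e) \<le> 1 / 2 * norm (A - a)"
proof -
  have e: "sre (ip e e) = 1" using assms by (simp add: ip_norm_def)
  have "sqrt q \<le> r \<longleftrightarrow> q \<le> r\<^sup>2" if "0 \<le> r" for q r :: real
    using that real_le_lsqrt real_sqrt_le_iff[of q "r\<^sup>2"] by simp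
  from this[of "1 / 2 * norm (A - a)"] show ?thesis
    by (simp add: sre_ip_eq_ball(1)[OF e] ip_norm_def)
qed

lemma sre_ip_residual_le:
  assumes e: "sre (ip e e) = 1" and R: "0 < sre (scnj a * A)"
    and h: "0 \<le> sre (ip (scale A e - x) (x - scale a e))"
  shows "sre (ip (x - scale (ip x e) e) (x - scale (ip x e) e)) \<le> (M a A * norm (ip x e) / 2)\<^sup>2"
proof -
  define p where "p = norm (ip x e)"
  define R where "R = sre (scnj a * A)"
  define S where "S = norm a + norm A"
  have R0: "0 < R" using R by (simp add: R_def)
  have "sre (scnj (a + A) * ip x e) \<le> norm (scnj (a + A) * ip x e)"
    using abs_sre_le_norm[of "scnj (a + A) * ip x e"] by linarith
  also have "\<dots> \<le> S * p"
    by (simp add: norm_mult S_def p_def norm_triangle_ineq mult_right_mono)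
  finally have "sre (ip x x) \<le> S * p - R"
    using h by (simp add: sre_ip_eq_ball(2)[OF e] R_def)
  moreover have "S * p \<le> R + (S * p)\<^sup>2 / (4 * R)"
  proof -
    \<comment> \<open>AM-GM as a square; equality holds exactly when
      \<open>p = 2 * R / S\<close>.\<close>
    have "0 \<le> (2 * R - S * p)\<^sup>2 / (4 * R)" using R0 by simp
    also have "\<dots> = R + (S * p)\<^sup>2 / (4 * R) - S * p"
      using R0 by (simp add: field_simps power2_eq_square)
    finally show ?thesis by simp
  qed
  ultimately have "sre (ip x x) - p\<^sup>2 \<le> (S * p)\<^sup>2 / (4 * R) - p\<^sup>2" by linarith
  \<comment> \<open>Subtracting \<open>p^2\<close> produces the \<open>- 4\<close> in
    \<open>M_square\<close>.\<close>
  also have "\<dots> = (M a A * p / 2)\<^sup>2"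
    unfolding power_mult_distrib power_divide M_square[OF R, folded R_def S_def]
    using R0 by (simp add: field_simps)
  finally show ?thesis
    by (simp add: sre_ip_diff_scale sre_scnj_mult_self e p_def)
qed

lemma Gruess_bound:
  assumes "ip_norm ip e = 1"
    and R: "0 < sre (scnj a * A)" "0 < sre (scnj b * B)"
    and h: "0 \<le> sre (ip (scale A e - x) (x - scale a e))"
      "0 \<le> sre (ip (scale B e - y) (y - scale b e))"
  shows "norm (ip x y - ip x e * ip e y) \<le> 1 / 4 * M a A * M b B * norm (ip x e * ip e y)"
proof -
  have e: "sre (ip e e) = 1" using assms(1) by (simp add: ip_norm_def)
  define x' y' where "x' = x - scale (ip x e) e" and "y' = y - scale (ip y e) e"
  have "ip e e = 1" using ip_self[of e] e by simp
  hence *: "ip x' y' = ip x y - ip x e * ip e y"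
    by (simp add: x'_def y'_def ip_diff_left ip_diff_right ip_scale_left ip_scale_right
        ip_commute[of e y] algebra_simps)
  have "(norm (ip x' y'))\<^sup>2 \<le> sre (ip x' x') * sre (ip y' y')"
    by (rule Cauchy_Schwarz)
  also have "\<dots> \<le> (M a A * norm (ip x e) / 2)\<^sup>2 * (M b B * norm (ip y e) / 2)\<^sup>2"
    unfolding x'_def y'_def
    by (intro mult_mono sre_ip_residual_le e R h ip_nonneg) simp
  also have "\<dots> = (1 / 4 * M a A * M b B * norm (ip x e * ip e y))\<^sup>2"
    by (simp add: norm_mult ip_commute[of e y] power2_eq_square)
  \<comment> \<open>Squares may be dropped because the right-hand side is nonnegative, by
    \<open>M_nonneg\<close>.\<close>
  finally show ?thesis
    unfolding * by (rule power2_le_imp_le) (simp add: M_nonneg R)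
qed

end

section \<open>Sharpness in the plane over the scalar field\<close>

definition pair_scale :: "'k :: rc_scalar \<Rightarrow> 'k \<times> 'k \<Rightarrow> 'k \<times> 'k" where
  "pair_scale k u = (k * fst u, k * snd u)"

definition pair_ip :: "'k :: rc_scalar \<times> 'k \<Rightarrow> 'k \<times> 'k \<Rightarrow> 'k" where
  "pair_ip u v = fst u * scnj (fst v) + snd u * scnj (snd v)"

lemma pair_ip_self:
  "pair_ip u u = of_real ((norm (fst u))\<^sup>2 + (norm (snd u))\<^sup>2)"
  by (simp only: pair_ip_def mult_scnj of_real_add)

lemma inner_product_space_pair: "inner_product_space pair_scale pair_ip"
proof
  fix u :: "'k :: rc_scalar \<times> 'k"
  show "0 \<le> sre (pair_ip u u)" by (simp only: pair_ip_self sre_of_real) simp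
  show "u = 0" if "pair_ip u u = 0"
    using that unfolding pair_ip_self of_real_eq_0_iff
    by (simp add: add_nonneg_eq_0_iff prod_eq_iff)
qed (auto simp: pair_scale_def pair_ip_def scnj_add scnj_mult algebra_simps)

text \<open>Two dimensions are used because in dimension one the residual orthogonal to
  \<open>e\<close> vanishes. Real coordinates let one example serve both fields.\<close>

lemma quarter_optimal:
  obtains x e :: "'k :: rc_scalar \<times> 'k" and a A :: 'k
  where "ip_norm pair_ip e = 1" "0 < sre (scnj a * A)"
    "0 \<le> sre (pair_ip (pair_scale A e - x) (x - pair_scale a e))"
    "\<And>c. norm (pair_ip x x - pair_ip x e * pair_ip e x)
      \<le> c * M a A * M a A * norm (pair_ip x e * pair_ip e x) \<Longrightarrow> 1 / 4 \<le> c"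
proof
  \<comment> \<open>With \<open>a = 1\<close> and \<open>A = 4\<close>, \<open>R = 4\<close> and
    \<open>S = 5\<close>. Equality in AM-GM forces the first coordinate
    \<open>2 * R / S = 8 / 5\<close>; equality in the hypothesis forces squared norm
    \<open>S * p - R = 4\<close>, hence second coordinate \<open>6 / 5\<close>.\<close>
  let ?x = "(of_real (8 / 5), of_real (6 / 5)) :: 'k \<times> 'k" and ?e = "(1, 0) :: 'k \<times> 'k"
  show "ip_norm pair_ip ?e = 1" by (simp add: ip_norm_def pair_ip_def)
  show R: "0 < sre (scnj 1 * 4 :: 'k)" by simp
  have "pair_ip (pair_scale 4 ?e - ?x) (?x - pair_scale 1 ?e) =
      of_real ((4 - 8 / 5) * (8 / 5 - 1) - (6 / 5) * (6 / 5))"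
    by (simp add: pair_ip_def pair_scale_def scnj_diff scnj_divide)
  thus "0 \<le> sre (pair_ip (pair_scale 4 ?e - ?x) (?x - pair_scale 1 ?e))"
    by (simp only: sre_of_real) simp
  have xe: "pair_ip ?x ?e = of_real (8 / 5)" "pair_ip ?e ?x = of_real (8 / 5)"
    by (simp_all add: pair_ip_def del: of_real_divide)
  have diff: "pair_ip ?x ?x - of_real (8 / 5) * of_real (8 / 5) = of_real (36 / 25)"
    by (simp add: pair_ip_def scnj_divide field_simps)
  have MM: "M 1 (4 :: 'k) * M 1 (4 :: 'k) = 9 / 4"
    using M_square[OF R] by (simp add: power2_eq_square)
  fix c
  assume "norm (pair_ip ?x ?x - pair_ip ?x ?e * pair_ip ?e ?x)
      \<le> c * M 1 (4 :: 'k) * M 1 (4 :: 'k) * norm (pair_ip ?x ?e * pair_ip ?e ?x)"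
  \<comment> \<open>With \<open>M^2 = 9 / 4\<close> the right-hand side becomes
    \<open>c * 144 / 25\<close>.\<close>
  hence "36 / 25 \<le> c * (M 1 (4 :: 'k) * M 1 (4 :: 'k)) * (8 / 5 * (8 / 5))"
    unfolding xe diff norm_mult norm_of_real by (simp add: mult.assoc)
  thus "1 / 4 \<le> c" unfolding MM by simp
qed

text \<open>Types cannot be quantified inside the formula, so optimality is stated on
  \<open>'k \<times> 'k\<close>; a constant failing there fails for the class of all spaces.\<close>

theorem theorem2:
  fixes scale :: "'k :: rc_scalar \<Rightarrow> 'v :: ab_group_add \<Rightarrow> 'v"
    and ip :: "'v \<Rightarrow> 'v \<Rightarrow> 'k"
  shows
    "(inner_product_space scale ip \<longrightarrow>
      (\<forall>x y e a A b B.
        ip_norm ip e = 1 \<and> 0 < sre (scnj a * A) \<and> 0 < sre (scnj b * B) \<longrightarrow>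
        ((0 \<le> sre (ip (scale A e - x) (x - scale a e)) \<and>
          0 \<le> sre (ip (scale B e - y) (y - scale b e)))
         \<longleftrightarrow>
         (ip_norm ip (x - scale ((a + A) / 2) e) \<le> 1 / 2 * norm (A - a) \<and>
          ip_norm ip (y - scale ((b + B) / 2) e) \<le> 1 / 2 * norm (B - b))) \<and>
        (0 \<le> sre (ip (scale A e - x) (x - scale a e)) \<and>
         0 \<le> sre (ip (scale B e - y) (y - scale b e)) \<longrightarrow>
         norm (ip x y - ip x e * ip e y)
           \<le> 1 / 4 * M a A * M b B * norm (ip x e * ip e y))))
     \<and>
     \<not> (\<exists>c :: real. c < 1 / 4 \<and>
          (\<forall>(scale' :: 'k \<Rightarrow> 'k \<times> 'k \<Rightarrow> 'k \<times> 'k) ip' x y e a A b B.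
            inner_product_space scale' ip' \<and>
            ip_norm ip' e = 1 \<and> 0 < sre (scnj a * A) \<and> 0 < sre (scnj b * B) \<and>
            0 \<le> sre (ip' (scale' A e - x) (x - scale' a e)) \<and>
            0 \<le> sre (ip' (scale' B e - y) (y - scale' b e)) \<longrightarrow>
            norm (ip' x y - ip' x e * ip' e y)
              \<le> c * M a A * M b B * norm (ip' x e * ip' e y)))"
proof (intro conjI impI allI notI, goal_cases)
  case (1 x y e a A b B)
  then interpret inner_product_space scale ip by simp
  show ?case using 1 by (simp only: sre_ip_nonneg_iff_ball)
next
  case (2 x y e a A b B)
  then interpret inner_product_space scale ip by simp
  show ?case using 2 by (intro Gruess_bound) auto
next
  case 3
  then obtain c where c: "c < 1 / 4"
    and bound: "\<And>(scale' :: 'k \<Rightarrow> 'k \<times> 'k \<Rightarrow> 'k \<times> 'k) ip' x y e a A b B.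
      inner_product_space scale' ip' \<Longrightarrow> ip_norm ip' e = 1 \<Longrightarrow>
      0 < sre (scnj a * A) \<Longrightarrow> 0 < sre (scnj b * B) \<Longrightarrow>
      0 \<le> sre (ip' (scale' A e - x) (x - scale' a e)) \<Longrightarrow>
      0 \<le> sre (ip' (scale' B e - y) (y - scale' b e)) \<Longrightarrow>
      norm (ip' x y - ip' x e * ip' e y) \<le> c * M a A * M b B * norm (ip' x e * ip' e y)"
    by blast
  show ?case
  proof (rule quarter_optimal)
    fix x e :: "'k \<times> 'k" and a A :: 'k
    assume h: "ip_norm pair_ip e = 1" "0 < sre (scnj a * A)"
      "0 \<le> sre (pair_ip (pair_scale A e - x) (x - pair_scale a e))"
      and opt: "\<And>c. norm (pair_ip x x - pair_ip x e * pair_ip e x)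
        \<le> c * M a A * M a A * norm (pair_ip x e * pair_ip e x) \<Longrightarrow> 1 / 4 \<le> c"
    have "1 / 4 \<le> c"
      \<comment> \<open>The bound is taken at \<open>y = x\<close>, \<open>b = a\<close>,
        \<open>B = A\<close>, hence the repeated facts.\<close>
      by (rule opt, rule bound[OF inner_product_space_pair h(1,2,2,3,3)])
    with c show ?case by simp
  qed
qed

end
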